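(* The following relations hold in $R/RI$ for any $J\subset[d]$: $$\partial_{y_i}P_J\equiv\begin{cases}\mu_i^J P_J+\sum_{j\in J}\sigma_{ij}^J P_{J\setminus\{j\}} & i\in J,\\ 0 & i\notin J,\end{cases}\qquad(1\le i\le d),$$ $$\partial_{x_{ij}}P_J\equiv\begin{cases}2\partial_{y_i}\partial_{y_j}P_J & \{i,j\}\subset J,\ i<j,\\ \partial_{y_i}^2P_J & \{i\}\subset J,\ i=j,\\ 0 & \text{otherwise,}\end{cases}\qquad(1\le i\le j\le d).$$
   Context: $[d]=\{1,\dots,d\}$. The variables are $x_{ij}$ ($1\le i\le j\le d$, with $x_{ij}=x_{ji}$) and $y_k$ ($1\le k\le d$), and $\partial_z=\partial/\partial z$. $D_{xy}$ is the Weyl algebra in these variables over $\mathbf{C}$, and $R=\mathbf{C}(x,y)\langle\partial_{x_{ij}},\partial_{y_k}\rangle$ is the ring of differential operators in these variables with rational function coefficients. $I\subset D_{xy}$ is the left ideal generated by $2\sum_{k=1}^d x_{ik}\partial_{y_i}\partial_{y_k}+y_i\partial_{y_i}+1$ ($1\le i\le d$), $\partial_{x_{ij}}-2\partial_{y_i}\partial_{y_j}$ ($1\le i<j\le d$), $\partial_{x_{ii}}-\partial_{y_i}^2$ ($1\le i\le d$); $RI$ is the left ideal of $R$ it generates. Put $Q_j=-\left(y_j+2\sum_{k=1}^d x_{jk}\partial_{y_k}\right)$; the $Q_j$ commute with each other. For $J\subset[d]$, $P_J=\prod_{j'\in[d]\setminus J}Q_{j'}$. For $J=\{j_1<\dots<j_s\}$,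 $x_J=(x_{j_kj_\ell})_{1\le k,\ell\le s}$, $y_J=(y_{j_1},\dots,y_{j_s})^T$, $\Sigma_J=-\frac12x_J^{-1}=(\sigma_{ij}^J)_{i,j\in J}$ and $\mu_J=\Sigma_Jy_J=(\mu_i^J)_{i\in J}$ (entries in $\mathbf{C}(x,y)$, indexed by elements of $J$). *)

theory Defs
  imports
    "HOL-Library.Poly_Mapping"
    "HOL-Computational_Algebra.Polynomial_Factorial"
    "Jordan_Normal_Form.Gauss_Jordan_Elimination"
begin

section \<open>Variables\<close>

text \<open>
  The index set \<open>[d]\<close> is (the universe of) an arbitrary finite linearly ordered type \<open>'n\<close>, with
  \<open>d = CARD('n)\<close>.  There is one variable \<open>x\<^sub>i\<^sub>j\<close> for every pair \<open>i \<le> j\<close> and one variable \<open>y\<^sub>k\<close>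
  for every \<open>k\<close>; \<open>xvar\<close> extends the former symmetrically to all pairs.
\<close>

typedef (overloaded) ('n::linorder) var =
  "{v :: ('n \<times> 'n) + 'n. case v of Inl (i, j) \<Rightarrow> i \<le> j | Inr k \<Rightarrow> True}"
  by (rule exI[of _ "Inr undefined"]) simp

setup_lifting type_definition_var

lift_definition xvar :: "'n::linorder \<Rightarrow> 'n \<Rightarrow> 'n var" is "\<lambda>i j. Inl (min i j, max i j)"
  by (auto simp: min_def max_def)

lift_definition yvar :: "'n::linorder \<Rightarrow> 'n var" is "\<lambda>k. Inr k"
  by simp

text \<open>
  The order on the variables plays no mathematical role: the library needs one on the exponent
  vectors for polynomials to form an integral domain.
\<close>

instantiation var :: (linorder) linorder
begin

lift_definition less_eq_var :: "'a var \<Rightarrow> 'a var \<Rightarrow> bool" is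
  "\<lambda>v w. case v of
      Inl (i, j) \<Rightarrow> (case w of Inl (k, l) \<Rightarrow> i < k \<or> i = k \<and> j \<le> l | Inr _ \<Rightarrow> True)
    | Inr i \<Rightarrow> (case w of Inl _ \<Rightarrow> False | Inr k \<Rightarrow> i \<le> k)" .

definition less_var :: "'a var \<Rightarrow> 'a var \<Rightarrow> bool" where
  "less_var v w \<longleftrightarrow> v \<le> w \<and> \<not> w \<le> v"

instance
proof
  fix u v w :: "'a var"
  show "u < v \<longleftrightarrow> u \<le> v \<and> \<not> v \<le> u" by (rule less_var_def)
  show "u \<le> u" by transfer (auto split: sum.splits)
  show "u \<le> v \<Longrightarrow> v \<le> w \<Longrightarrow> u \<le> w" by transfer (auto split: sum.splits)
  show "u \<le> v \<Longrightarrow> v \<le> u \<Longrightarrow> u = v" by transfer (auto split: sum.splits)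
  show "u \<le> v \<or> v \<le> u" by transfer (auto split: sum.splits simp: not_le)
qed

end

lifting_forget var.lifting


section \<open>Rational functions and their partial derivatives\<close>

type_synonym 'n polys = "('n var \<Rightarrow>\<^sub>0 nat) \<Rightarrow>\<^sub>0 complex"
type_synonym 'n ratfun = "'n polys fract"

definition var_poly :: "'n::linorder var \<Rightarrow> 'n polys" where
  "var_poly v = Poly_Mapping.single (Poly_Mapping.single v 1) 1"

definition rx :: "'n::linorder \<Rightarrow> 'n \<Rightarrow> 'n ratfun" where
  "rx i j = to_fract (var_poly (xvar i j))"

definition ry :: "'n::linorder \<Rightarrow> 'n ratfun" where
  "ry k = to_fract (var_poly (yvar k))"

text \<open>The coefficient of \<open>z\<^sup>m\<close> in \<open>\<partial>p/\<partial>z\<^sub>v\<close> is \<open>m\<^sub>v + 1\<close> times that of \<open>z\<^sup>m z\<^sub>v\<close> in \<open>p\<close>.\<close>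

lift_definition poly_deriv :: "'n::linorder var \<Rightarrow> 'n polys \<Rightarrow> 'n polys" is
  "\<lambda>v p m. of_nat (Poly_Mapping.lookup m v + 1) * p (m + Poly_Mapping.single v 1)"
proof -
  fix v :: "'n var" and p :: "('n var \<Rightarrow>\<^sub>0 nat) \<Rightarrow> complex"
  assume fin: "finite {m. p m \<noteq> 0}"
  have "inj (\<lambda>m. m + Poly_Mapping.single v (1::nat))"
    by (simp add: inj_def)
  then have "finite ((\<lambda>m. m + Poly_Mapping.single v 1) -` {m. p m \<noteq> 0})"
    using fin by (intro finite_vimageI) auto
  then show "finite {m. of_nat (Poly_Mapping.lookup m v + 1) * p (m + Poly_Mapping.single v 1) \<noteq> 0}"
    by (rule rev_finite_subset) auto
qed

lemma poly_deriv_add: "poly_deriv v (p + q) = poly_deriv v p + poly_deriv v q"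
  by (intro poly_mapping_eqI) (simp add: poly_deriv.rep_eq lookup_add algebra_simps)

lemma poly_deriv_single:
  "poly_deriv v (Poly_Mapping.single m c) =
    Poly_Mapping.single (m - Poly_Mapping.single v 1) (of_nat (Poly_Mapping.lookup m v) * c)"
proof (rule poly_mapping_eqI)
  fix k
  show "Poly_Mapping.lookup (poly_deriv v (Poly_Mapping.single m c)) k =
    Poly_Mapping.lookup
      (Poly_Mapping.single (m - Poly_Mapping.single v 1) (of_nat (Poly_Mapping.lookup m v) * c)) k"
  proof (cases "Poly_Mapping.lookup m v = 0")
    case True
    then have "m \<noteq> k + Poly_Mapping.single v 1"
      by (auto simp: lookup_add)
    with True show ?thesis
      by (simp add: poly_deriv.rep_eq lookup_single)
  next
    case False
    then have "m - Poly_Mapping.single v 1 + Poly_Mapping.single v 1 = m"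
      by (intro poly_mapping_eqI) (auto simp: lookup_add lookup_minus lookup_single when_def)
    then have "m = k + Poly_Mapping.single v 1 \<longleftrightarrow> m - Poly_Mapping.single v 1 = k"
      by (metis add_diff_cancel_right')
    with False show ?thesis
      by (auto simp: poly_deriv.rep_eq lookup_single when_def lookup_add lookup_minus)
  qed
qed

lemma polys_induct [case_names zero single add]:
  fixes p :: "'n::linorder polys"
  assumes "P 0" "\<And>m c. P (Poly_Mapping.single m c)" "\<And>p q. P p \<Longrightarrow> P q \<Longrightarrow> P (p + q)"
  shows "P p"
proof -
  have "P (\<Sum>m\<in>S. Poly_Mapping.single m (Poly_Mapping.lookup p m))" if "finite S" for S
    using that by (induction S) (auto intro: assms)
  moreover have "(\<Sum>m\<in>Poly_Mapping.keys p. Poly_Mapping.single m (Poly_Mapping.lookup p m)) = p"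
    by (intro poly_mapping_eqI) (auto simp: lookup_sum lookup_single when_def in_keys_iff)
  ultimately show ?thesis
    by (metis finite_keys)
qed

lemma poly_deriv_zero: "poly_deriv v 0 = 0"
  using poly_deriv_add[of v 0 0] by simp

lemma poly_deriv_mult: "poly_deriv v (p * q) = poly_deriv v p * q + p * poly_deriv v q"
proof (induction p rule: polys_induct)
  case zero
  then show ?case by (simp add: poly_deriv_zero)
next
  case (add p1 p2)
  then show ?case by (simp add: poly_deriv_add algebra_simps)
next
  case (single m c)
  show ?case
  proof (induction q rule: polys_induct)
    case zero
    then show ?case by (simp add: poly_deriv_zero)
  next
    case (add q1 q2)
    then show ?case by (simp add: poly_deriv_add algebra_simps)
  next
    case (single n e)
    let ?s = "Poly_Mapping.single v (1::nat)"
    have 1: "(m - ?s) + n = m + n - ?s" if "Poly_Mapping.lookup m v \<noteq> 0" for m n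
      using that by (intro poly_mapping_eqI) (auto simp: lookup_add lookup_minus lookup_single when_def)
    have 2: "Poly_Mapping.single (m - ?s + n) (of_nat (Poly_Mapping.lookup m v) * c * e) =
        Poly_Mapping.single (m + n - ?s) (of_nat (Poly_Mapping.lookup m v) * c * e)"
      using 1[of m n] by (cases "Poly_Mapping.lookup m v = 0") simp_all
    have 3: "Poly_Mapping.single (m + (n - ?s)) (c * (of_nat (Poly_Mapping.lookup n v) * e)) =
        Poly_Mapping.single (m + n - ?s) (c * (of_nat (Poly_Mapping.lookup n v) * e))"
      using 1[of n m] by (cases "Poly_Mapping.lookup n v = 0") (simp_all add: add.commute)
    show ?case
      unfolding poly_deriv_single mult_single 2 3 lookup_add single_add[symmetric]
      by (simp add: algebra_simps)
  qed
qed

text \<open>The quotient rule; by \<open>rat_deriv_Fract\<close> below the choice of the fraction is immaterial.\<close>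

definition rat_deriv :: "'n::linorder var \<Rightarrow> 'n ratfun \<Rightarrow> 'n ratfun" where
  "rat_deriv v f = (case (SOME (p, q). q \<noteq> 0 \<and> f = Fraction_Field.Fract p q) of (p, q) \<Rightarrow>
     Fraction_Field.Fract (poly_deriv v p * q - p * poly_deriv v q) (q * q))"

lemma quotient_rule_cong:
  fixes a b c d :: "'n::linorder polys"
  assumes "b \<noteq> 0" "d \<noteq> 0" "a * d = c * b"
  shows "Fraction_Field.Fract (poly_deriv v a * b - a * poly_deriv v b) (b * b) =
    Fraction_Field.Fract (poly_deriv v c * d - c * poly_deriv v d) (d * d)"
proof -
  let ?D = "poly_deriv v"
  have D: "?D a * d + a * ?D d = ?D c * b + c * ?D b"
    using arg_cong[OF assms(3), of ?D] by (simp add: poly_deriv_mult)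
  have "(?D a * b - a * ?D b) * (d * d) = b * d * (?D a * d) - ?D b * d * (a * d)"
    by (simp add: algebra_simps)
  also have "?D a * d = ?D c * b + c * ?D b - a * ?D d"
    using D by (simp add: algebra_simps)
  also have "b * d * (?D c * b + c * ?D b - a * ?D d) - ?D b * d * (a * d) =
      b * d * (?D c * b + c * ?D b) - b * ?D d * (a * d) - ?D b * d * (a * d)"
    by (simp add: algebra_simps)
  also have "\<dots> = (?D c * d - c * ?D d) * (b * b)"
    unfolding assms(3) by (simp add: algebra_simps)
  finally show ?thesis
    using assms(1,2) by (simp add: eq_fract)
qed

lemma rat_deriv_Fract:
  assumes "q \<noteq> 0"
  shows "rat_deriv v (Fraction_Field.Fract p q) =
    Fraction_Field.Fract (poly_deriv v p * q - p * poly_deriv v q) (q * q)"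
proof -
  let ?R = "\<lambda>r. case r of (p', q') \<Rightarrow> q' \<noteq> 0 \<and> Fraction_Field.Fract p q = Fraction_Field.Fract p' q'"
  have "?R (SOME r. ?R r)"
    using assms by (intro someI[of ?R "(p, q)"]) simp
  moreover obtain p' q' where "(SOME r. ?R r) = (p', q')"
    by fastforce
  ultimately have eq: "(SOME r. ?R r) = (p', q')" and *: "q' \<noteq> 0" "p * q' = p' * q"
    using eq_fract(1)[OF assms] by auto
  show ?thesis
    unfolding rat_deriv_def eq using quotient_rule_cong[OF assms *] by simp
qed

lemma rat_deriv_add: "rat_deriv v (f + g) = rat_deriv v f + rat_deriv v g"
  by (cases f, cases g)
    (simp add: rat_deriv_Fract eq_fract poly_deriv_add poly_deriv_mult, simp add: algebra_simps)

lemma rat_deriv_mult: "rat_deriv v (f * g) = rat_deriv v f * g + f * rat_deriv v g"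
  by (cases f, cases g)
    (simp add: rat_deriv_Fract eq_fract poly_deriv_add poly_deriv_mult, simp add: algebra_simps)


section \<open>The ring \<open>R\<close> of differential operators\<close>

text \<open>
  \<open>R = \<complex>(x,y)\<langle>\<partial>\<rangle>\<close> consists of the operators on \<open>\<complex>(x,y)\<close> that are obtained from the
  multiplications by rational functions and the partial derivatives by sums and compositions.
  As the characteristic is \<open>0\<close>, \<open>R\<close> acts faithfully on \<open>\<complex>(x,y)\<close>, so this is the same as the
  algebra presented by the Leibniz and commutation relations.
\<close>

inductive_set diffops :: "('n::linorder ratfun \<Rightarrow> 'n ratfun) set" where
  mult: "(\<lambda>f. a * f) \<in> diffops"
| deriv: "rat_deriv v \<in> diffops"
| add: "A \<in> diffops \<Longrightarrow> B \<in> diffops \<Longrightarrow> (\<lambda>f. A f + B f) \<in> diffops"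
| comp: "A \<in> diffops \<Longrightarrow> B \<in> diffops \<Longrightarrow> A \<circ> B \<in> diffops"

lemma diffops_add: "A \<in> diffops \<Longrightarrow> A (f + g) = A f + A g"
  by (induction arbitrary: f g rule: diffops.induct) (simp_all add: rat_deriv_add algebra_simps)

typedef (overloaded) ('n::linorder) diffop = "diffops :: ('n ratfun \<Rightarrow> 'n ratfun) set"
  morphisms apply_op Abs_diffop
  using diffops.mult by blast

lemma diffop_eqI: "(\<And>f. apply_op A f = apply_op B f) \<Longrightarrow> A = B"
  by (simp add: apply_op_inject[symmetric] fun_eq_iff)

definition coef :: "'n::linorder ratfun \<Rightarrow> 'n diffop" where
  "coef a = Abs_diffop (\<lambda>f. a * f)"

definition pd :: "'n::linorder var \<Rightarrow> 'n diffop" where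
  "pd v = Abs_diffop (rat_deriv v)"

lemma apply_coef [simp]: "apply_op (coef a) f = a * f"
  by (simp add: coef_def Abs_diffop_inverse diffops.mult)

lemma apply_pd [simp]: "apply_op (pd v) f = rat_deriv v f"
  by (simp add: pd_def Abs_diffop_inverse diffops.deriv)

lemma apply_op_arg_add: "apply_op A (f + g) = apply_op A f + apply_op A g"
  using apply_op[of A] by (rule diffops_add)

instantiation diffop :: (linorder) ring_1
begin

definition zero_diffop :: "'a diffop" where
  "0 = coef 0"

definition one_diffop :: "'a diffop" where
  "1 = coef 1"

definition plus_diffop :: "'a diffop \<Rightarrow> 'a diffop \<Rightarrow> 'a diffop" where
  "A + B = Abs_diffop (\<lambda>f. apply_op A f + apply_op B f)"

definition times_diffop :: "'a diffop \<Rightarrow> 'a diffop \<Rightarrow> 'a diffop" where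
  "A * B = Abs_diffop (apply_op A \<circ> apply_op B)"

definition uminus_diffop :: "'a diffop \<Rightarrow> 'a diffop" where
  "- A = coef (- 1) * A"

definition minus_diffop :: "'a diffop \<Rightarrow> 'a diffop \<Rightarrow> 'a diffop" where
  "A - B = A + - (B :: 'a diffop)"

lemma apply_zero: "apply_op (0 :: 'a diffop) f = 0"
  by (simp add: zero_diffop_def)

lemma apply_one: "apply_op (1 :: 'a diffop) f = f"
  by (simp add: one_diffop_def)

lemma apply_plus: "apply_op (A + B :: 'a diffop) f = apply_op A f + apply_op B f"
  by (simp add: plus_diffop_def Abs_diffop_inverse apply_op diffops.add)

lemma apply_times: "apply_op (A * B :: 'a diffop) f = apply_op A (apply_op B f)"
  by (simp add: times_diffop_def Abs_diffop_inverse apply_op diffops.comp)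

lemma apply_uminus: "apply_op (- A :: 'a diffop) f = - apply_op A f"
  by (simp add: uminus_diffop_def apply_times)

lemmas apply_ring = apply_zero apply_one apply_plus apply_times apply_uminus

instance
proof
  fix A B C :: "'a diffop"
  show "A * B * C = A * (B * C)" by (rule diffop_eqI) (simp add: apply_ring)
  show "A + B + C = A + (B + C)" by (rule diffop_eqI) (simp add: apply_ring add.assoc)
  show "A + B = B + A" by (rule diffop_eqI) (simp add: apply_ring add.commute)
  show "0 + A = A" by (rule diffop_eqI) (simp add: apply_ring)
  show "- A + A = 0" by (rule diffop_eqI) (simp add: apply_ring)
  show "A - B = A + - B" by (rule minus_diffop_def)
  show "1 * A = A" by (rule diffop_eqI) (simp add: apply_ring)
  show "A * 1 = A" by (rule diffop_eqI) (simp add: apply_ring)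
  show "(A + B) * C = A * C + B * C" by (rule diffop_eqI) (simp add: apply_ring)
  show "A * (B + C) = A * B + A * C" by (rule diffop_eqI) (simp add: apply_ring apply_op_arg_add)
  show "(0::'a diffop) \<noteq> 1" by (metis apply_zero apply_one zero_neq_one)
qed

end

lemma pd_coef: "pd v * coef a = coef a * pd v + coef (rat_deriv v a)"
  by (rule diffop_eqI) (simp add: apply_ring rat_deriv_mult algebra_simps)

definition dx :: "'n::linorder \<Rightarrow> 'n \<Rightarrow> 'n diffop" where
  "dx i j = pd (xvar i j)"

definition dy :: "'n::linorder \<Rightarrow> 'n diffop" where
  "dy k = pd (yvar k)"

inductive_set weyl :: "'n::linorder diffop set" where
  poly: "coef (to_fract p) \<in> weyl"
| deriv: "pd v \<in> weyl"
| add: "A \<in> weyl \<Longrightarrow> B \<in> weyl \<Longrightarrow> A + B \<in> weyl"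
| mult: "A \<in> weyl \<Longrightarrow> B \<in> weyl \<Longrightarrow> A * B \<in> weyl"


section \<open>The ideals\<close>

definition left_ideal :: "'r::ring_1 set \<Rightarrow> 'r set \<Rightarrow> bool" where
  "left_ideal S L \<longleftrightarrow> L \<subseteq> S \<and> 0 \<in> L \<and> (\<forall>a\<in>L. \<forall>b\<in>L. a + b \<in> L) \<and> (\<forall>r\<in>S. \<forall>a\<in>L. r * a \<in> L)"

definition generators :: "'n::{finite,linorder} diffop set" where
  "generators =
     {2 * (\<Sum>k\<in>UNIV. coef (rx i k) * dy i * dy k) + coef (ry i) * dy i + 1 | i. True}
   \<union> {dx i j - 2 * dy i * dy j | i j. i < j}
   \<union> {dx i i - dy i ^ 2 | i. True}"

lemma generators_subset_weyl: "generators \<subseteq> weyl"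
proof -
  have one: "1 \<in> weyl"
    using weyl.poly[of 1] by (simp add: one_diffop_def)
  have two: "2 \<in> weyl"
    using weyl.add[OF one one] by simp
  have uminus: "- A \<in> weyl" if "A \<in> weyl" for A :: "'a diffop"
  proof -
    have "- A = coef (to_fract (- 1)) * A"
      by (simp add: uminus_diffop_def)
    then show ?thesis
      using weyl.mult[OF weyl.poly[of "- 1"] that] by simp
  qed
  have diff: "A - B \<in> weyl" if "A \<in> weyl" "B \<in> weyl" for A B :: "'a diffop"
    using weyl.add[OF that(1) uminus[OF that(2)]] by simp
  have sum: "sum A K \<in> weyl" if "\<And>k. A k \<in> weyl" for A :: "'a \<Rightarrow> 'a diffop" and K
  proof (induction K rule: infinite_finite_induct)
    case (insert k K)
    then show ?case using that by (simp add: weyl.add)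
  qed (use diff[OF one one] in simp_all)
  show ?thesis
    unfolding generators_def dx_def dy_def rx_def ry_def power2_eq_square
    by (auto intro!: weyl.intros diff sum one two)
qed

definition I_xy :: "'n::{finite,linorder} diffop set" where
  "I_xy = left_ideal weyl hull generators"

definition RI :: "'n::{finite,linorder} diffop set" where
  "RI = left_ideal UNIV hull I_xy"

definition cong_RI :: "'n::{finite,linorder} diffop \<Rightarrow> 'n diffop \<Rightarrow> bool"
    (infix \<open>\<equiv>\<^sub>R\<^sub>I\<close> 50) where
  "A \<equiv>\<^sub>R\<^sub>I B \<longleftrightarrow> A - B \<in> RI"


section \<open>The operators \<open>P\<^sub>J\<close> and the coefficients \<open>\<Sigma>\<^sub>J\<close>, \<open>\<mu>\<^sub>J\<close>\<close>

definition Q_op :: "'n::{finite,linorder} \<Rightarrow> 'n diffop" where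
  "Q_op j = - (coef (ry j) + 2 * (\<Sum>k\<in>UNIV. coef (rx j k) * dy k))"

text \<open>The \<open>Q\<^sub>j\<close> commute, so multiplying them in increasing order of \<open>j\<close> is no restriction.\<close>

definition P_op :: "'n::{finite,linorder} set \<Rightarrow> 'n diffop" where
  "P_op J = prod_list (map Q_op (sorted_list_of_set (- J)))"

text \<open>Rows and columns are numbered from \<open>0\<close>; \<open>pos J i\<close> is the number of the one belonging to \<open>i\<close>.\<close>

definition elt :: "'n::{finite,linorder} set \<Rightarrow> nat \<Rightarrow> 'n" where
  "elt J k = sorted_list_of_set J ! k"

definition pos :: "'n::{finite,linorder} set \<Rightarrow> 'n \<Rightarrow> nat" where
  "pos J i = card {j \<in> J. j < i}"

definition x_mat :: "'n::{finite,linorder} set \<Rightarrow> 'n ratfun mat" where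
  "x_mat J = mat (card J) (card J) (\<lambda>(k, l). rx (elt J k) (elt J l))"

definition y_vec :: "'n::{finite,linorder} set \<Rightarrow> 'n ratfun vec" where
  "y_vec J = vec (card J) (\<lambda>k. ry (elt J k))"

text \<open>\<open>x_mat J\<close> is invertible, so \<open>mat_inverse\<close> does return its inverse.\<close>

definition Sigma_mat :: "'n::{finite,linorder} set \<Rightarrow> 'n ratfun mat" where
  "Sigma_mat J = (- 1 / 2) \<cdot>\<^sub>m the (mat_inverse (x_mat J))"

definition mu_vec :: "'n::{finite,linorder} set \<Rightarrow> 'n ratfun vec" where
  "mu_vec J = Sigma_mat J *\<^sub>v y_vec J"

definition sigma :: "'n::{finite,linorder} set \<Rightarrow> 'n \<Rightarrow> 'n \<Rightarrow> 'n ratfun" where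
  "sigma J i j = Sigma_mat J $$ (pos J i, pos J j)"

definition mu :: "'n::{finite,linorder} set \<Rightarrow> 'n \<Rightarrow> 'n ratfun" where
  "mu J i = mu_vec J $ pos J i"

end

theory Submission
  imports Defs "Jordan_Normal_Form.Determinant"
begin

text \<open>
  Up to sign, the first generators of \<open>I\<close> are the products \<open>\<partial>\<^sub>y\<^sub>i Q\<^sub>i\<close>, and \<open>\<partial>\<^sub>y\<^sub>i\<close> commutes with \<open>Q\<^sub>j\<close>
  for \<open>j \<noteq> i\<close>; hence \<open>\<partial>\<^sub>y\<^sub>i P\<^sub>J \<equiv> 0\<close> if \<open>i \<notin> J\<close>.  For \<open>j \<in> J\<close> the identity \<open>Q\<^sub>j P\<^sub>J = P\<^bsub>J - {j}\<^esub>\<close> thus becomes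
  \<open>2 \<Sum>\<^bsub>k \<in> J\<^esub> x\<^sub>j\<^sub>k \<partial>\<^sub>y\<^sub>k P\<^sub>J \<equiv> - y\<^sub>j P\<^sub>J - P\<^bsub>J - {j}\<^esub>\<close>, a linear system with matrix \<open>x\<^sub>J\<close>.  It can be solved,
  because \<open>det x\<^sub>J\<close> takes the value \<open>1\<close> at the identity matrix.
\<close>

section \<open>Derivatives of rational functions\<close>

lemma poly_deriv_commute: "poly_deriv v (poly_deriv w p) = poly_deriv w (poly_deriv v p)"
  by (intro poly_mapping_eqI)
    (auto simp: poly_deriv.rep_eq lookup_add lookup_single when_def algebra_simps)

lemma poly_deriv_one: "poly_deriv v 1 = 0"
  using poly_deriv_mult[of v 1 1] by simp

lemma poly_deriv_var_poly: "poly_deriv v (var_poly w) = of_bool (v = w)"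
  by (auto simp: var_poly_def poly_deriv_single lookup_single when_def)

lemma rat_deriv_to_fract: "rat_deriv v (to_fract p) = to_fract (poly_deriv v p)"
  by (simp add: to_fract_def rat_deriv_Fract poly_deriv_one)

text \<open>The commutator of two derivations is a derivation; it vanishes on polynomials, hence on
  their quotients.\<close>

lemma rat_deriv_commute: "rat_deriv v (rat_deriv w f) = rat_deriv w (rat_deriv v f)"
proof -
  define C where "C f = rat_deriv v (rat_deriv w f) - rat_deriv w (rat_deriv v f)" for f
  have C_mult: "C (f * g) = C f * g + f * C g" for f g
    by (simp add: C_def rat_deriv_add rat_deriv_mult algebra_simps)
  have C_poly: "C (to_fract p) = 0" for p
    by (simp add: C_def rat_deriv_to_fract poly_deriv_commute)
  obtain p q where f: "f = Fraction_Field.Fract p q" and q: "q \<noteq> 0"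
    by (cases f)
  have "f * to_fract q = to_fract p"
    using q by (simp add: f Fract_conv_to_fract)
  then have "C f * to_fract q = 0"
    using C_mult[of f "to_fract q"] by (simp add: C_poly)
  then show ?thesis
    using q by (simp add: C_def)
qed

lemma xvar_commute: "xvar i j = xvar j i"
  by (simp add: xvar_def min.commute max.commute)

text \<open>Minimum and maximum together determine an unordered pair.\<close>

lemma xvar_eq_iff: "xvar i j = xvar k l \<longleftrightarrow> i = k \<and> j = l \<or> i = l \<and> j = k"
proof -
  have "xvar i j = xvar k l \<longleftrightarrow> min i j = min k l \<and> max i j = max k l"
    unfolding xvar_def by (simp, subst Abs_var_inject) (auto simp: min_def max_def)
  then show ?thesis
    by (auto simp: min_def max_def split: if_splits)
qed

lemma xvar_neq_yvar [simp]: "xvar i j \<noteq> yvar k" "yvar k \<noteq> xvar i j"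
  unfolding xvar_def yvar_def by (simp_all, (subst Abs_var_inject; auto simp: min_def max_def)+)

lemma yvar_eq_iff [simp]: "yvar k = yvar l \<longleftrightarrow> k = l"
  unfolding yvar_def by (simp, subst Abs_var_inject) auto

lemma rx_commute: "rx i j = rx j i"
  by (simp add: rx_def xvar_commute)

lemma rat_deriv_rx: "rat_deriv v (rx i j) = of_bool (v = xvar i j)"
  by (auto simp: rx_def rat_deriv_to_fract poly_deriv_var_poly)

lemma rat_deriv_ry: "rat_deriv v (ry i) = of_bool (v = yvar i)"
  by (auto simp: ry_def rat_deriv_to_fract poly_deriv_var_poly)


section \<open>Commutation relations\<close>

lemma coef_0 [simp]: "coef 0 = 0"
  by (simp add: zero_diffop_def)

lemma coef_1 [simp]: "coef 1 = 1"
  by (simp add: one_diffop_def)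

lemma coef_of_bool [simp]: "coef (of_bool b) = of_bool b"
  by (cases b) simp_all

lemma coef_add: "coef (a + b) = coef a + coef b"
  by (rule diffop_eqI) (simp add: apply_ring algebra_simps)

lemma coef_mult: "coef (a * b) = coef a * coef b"
  by (rule diffop_eqI) (simp add: apply_ring algebra_simps)

lemma coef_uminus: "coef (- a) = - coef a"
  by (rule diffop_eqI) (simp add: apply_ring)

lemma coef_sum: "coef (\<Sum>i\<in>A. f i) = (\<Sum>i\<in>A. coef (f i))"
  by (induction A rule: infinite_finite_induct) (simp_all add: coef_add)

lemma coef_commute: "coef a * coef b = coef b * coef a"
  by (simp add: coef_mult[symmetric] mult.commute)

lemma pd_commute: "pd v * pd w = pd w * pd v"
  by (rule diffop_eqI) (simp add: apply_ring rat_deriv_commute)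

lemma dy_commute: "dy i * dy j = dy j * dy i"
  by (simp add: dy_def pd_commute)

lemma Q_op_alt:
  "Q_op j = - coef (ry j) - 2 * (\<Sum>k\<in>UNIV. coef (rx j k) * dy k)"
  by (simp add: Q_op_def)

text \<open>Every \<open>pd v\<close> commutes with the \<open>dy k\<close>, so by the Leibniz rule
  the commutator consists of the derivatives of the coefficients of \<open>Q_op j\<close>.\<close>

lemma pd_Q_op:
  "pd v * Q_op j = Q_op j * pd v - of_bool (v = yvar j)
     - 2 * (\<Sum>k\<in>UNIV. of_bool (v = xvar j k) * dy k)"
proof -
  have "pd v * (coef (rx j k) * dy k) = coef (rx j k) * dy k * pd v + of_bool (v = xvar j k) * dy k"
    for k
    using pd_commute[of v "yvar k"]
    by (simp add: mult.assoc[symmetric] pd_coef rat_deriv_rx distrib_right dy_def)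
      (simp add: mult.assoc)
  then have "pd v * (\<Sum>k\<in>UNIV. coef (rx j k) * dy k) = (\<Sum>k\<in>UNIV. coef (rx j k) * dy k) * pd v
      + (\<Sum>k\<in>UNIV. of_bool (v = xvar j k) * dy k)"
    by (simp add: sum_distrib_left sum_distrib_right sum.distrib)
  moreover have "pd v * coef (ry j) = coef (ry j) * pd v + of_bool (v = yvar j)"
    by (simp add: pd_coef rat_deriv_ry)
  ultimately show ?thesis
    by (simp add: Q_op_alt mult_2 algebra_simps)
qed

lemma dy_Q_op: "dy i * Q_op j = Q_op j * dy i - of_bool (i = j)"
  by (simp add: dy_def pd_Q_op)

lemma dx_Q_op_neq:
  assumes "i \<noteq> j"
  shows "dx i j * Q_op k =
    Q_op k * dx i j - 2 * (of_bool (i = k) * dy j + of_bool (j = k) * dy i)"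
proof -
  \<comment> \<open>As \<open>i \<noteq> j\<close>, the cases \<open>k = i, l = j\<close> and
    \<open>k = j, l = i\<close> exclude each other, so the indicator splits into a sum.\<close>
  have "(\<Sum>l\<in>UNIV. of_bool (xvar i j = xvar k l) * dy l)
      = (\<Sum>l\<in>UNIV. (if l = j then of_bool (i = k) * dy l else 0)
          + (if l = i then of_bool (j = k) * dy l else 0))"
    using assms by (intro sum.cong) (auto simp: xvar_eq_iff)
  also have "\<dots> = of_bool (i = k) * dy j + of_bool (j = k) * dy i"
    by (simp add: sum.distrib)
  finally show ?thesis
    by (simp add: dx_def pd_Q_op)
qed

lemma dx_Q_op_eq: "dx i i * Q_op k = Q_op k * dx i i - 2 * of_bool (k = i) * dy i"
proof -
  have "(\<Sum>l\<in>UNIV. of_bool (xvar i i = xvar k l) * dy l)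
      = (\<Sum>l\<in>UNIV. (if l = i then of_bool (k = i) * dy l else 0))"
    by (intro sum.cong) (auto simp: xvar_eq_iff)
  also have "\<dots> = of_bool (k = i) * dy i"
    by simp
  finally show ?thesis
    by (simp add: dx_def pd_Q_op mult.assoc)
qed

text \<open>Only the first-order part of \<open>Q_op k\<close> differentiates \<open>a\<close>, so
  the commutator is again a multiplication operator.\<close>

lemma Q_op_coef:
  "Q_op k * coef a = coef a * Q_op k - 2 * (\<Sum>l\<in>UNIV. coef (rx k l * rat_deriv (yvar l) a))"
proof -
  have "coef (rx k l) * dy l * coef a
      = coef a * (coef (rx k l) * dy l) + coef (rx k l * rat_deriv (yvar l) a)" for l
    using coef_commute[of a "rx k l"]
    by (simp add: mult.assoc dy_def pd_coef distrib_left coef_mult) (simp add: mult.assoc[symmetric])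
  then have "(\<Sum>l\<in>UNIV. coef (rx k l) * dy l) * coef a
      = coef a * (\<Sum>l\<in>UNIV. coef (rx k l) * dy l)
        + (\<Sum>l\<in>UNIV. coef (rx k l * rat_deriv (yvar l) a))"
    by (simp add: sum_distrib_left sum_distrib_right sum.distrib)
  then show ?thesis
    using coef_commute[of a "ry k"] by (simp add: Q_op_alt mult_2 algebra_simps)
qed

text \<open>Two corrections cancel: moving \<open>Q_op k\<close> to the right past
  \<open>coef (ry j)\<close> gives \<open>- 2 * coef (rx j k)\<close>, and past twice the derivative
  sum of \<open>Q_op j\<close> it gives \<open>2 * coef (rx j k)\<close>. The symmetry of
  \<open>rx\<close> enters here.\<close>

lemma Q_op_commute: "Q_op j * Q_op k = Q_op k * Q_op j"
proof -
  have "Q_op k * (coef (rx j l) * dy l)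
      = coef (rx j l) * dy l * Q_op k + (if l = k then coef (rx j l) else 0)" for l
  proof -
    have "Q_op k * (coef (rx j l) * dy l) = coef (rx j l) * (Q_op k * dy l)"
      by (simp add: mult.assoc[symmetric] Q_op_coef rat_deriv_rx)
    also have "Q_op k * dy l = dy l * Q_op k + of_bool (l = k)"
      by (simp add: dy_Q_op)
    finally show ?thesis
      by (simp add: distrib_left mult.assoc)
  qed
  then have "Q_op k * (\<Sum>l\<in>UNIV. coef (rx j l) * dy l)
      = (\<Sum>l\<in>UNIV. coef (rx j l) * dy l) * Q_op k + coef (rx j k)"
    by (simp add: sum_distrib_left sum_distrib_right sum.distrib)
  moreover have "Q_op k * coef (ry j) = coef (ry j) * Q_op k - 2 * coef (rx j k)"
  proof -
    have "(\<Sum>l\<in>UNIV. coef (rx k l * rat_deriv (yvar l) (ry j)))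
        = (\<Sum>l\<in>UNIV. if l = j then coef (rx k l) else 0)"
      by (intro sum.cong) (auto simp: rat_deriv_ry)
    then show ?thesis
      by (simp add: Q_op_coef rx_commute)
  qed
  ultimately show ?thesis
    by (simp add: Q_op_alt[of j] mult_2 algebra_simps)
qed

section \<open>Products of the operators \<open>Q_op j\<close>\<close>

lemma commute_prod_list_map:
  fixes a :: "'r::monoid_mult"
  assumes "\<And>x. x \<in> set xs \<Longrightarrow> a * f x = f x * a"
  shows "a * prod_list (map f xs) = prod_list (map f xs) * a"
  using assms
proof (induction xs)
  case (Cons x xs)
  have "a * f x = f x * a" "a * prod_list (map f xs) = prod_list (map f xs) * a"
    using Cons by simp_all
  then show ?case
    by (metis list.simps(9) mult.assoc prod_list.Cons)
qed simp

lemma P_op_commute: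
  assumes "\<And>j. j \<notin> J \<Longrightarrow> A * Q_op j = Q_op j * A"
  shows "A * P_op J = P_op J * A"
  unfolding P_op_def using assms by (intro commute_prod_list_map) simp

lemma P_op_Diff_singleton:
  assumes "j \<in> J"
  shows "P_op (J - {j}) = Q_op j * P_op J"
proof -
  \<comment> \<open>The sorted product may receive \<open>Q_op j\<close> in the middle;
    commutativity brings it to the front.\<close>
  have insort: "prod_list (map Q_op (insort j xs)) = Q_op j * prod_list (map Q_op xs)" for xs
  proof (induction xs)
    case (Cons x xs)
    then show ?case
      using Q_op_commute[of x j] by (simp add: mult.assoc[symmetric])
  qed simp
  have "- (J - {j}) = insert j (- J)" "- J - {j} = - J"
    using assms by auto
  then show ?thesis
    by (simp add: P_op_def insort sorted_list_of_set_insert_remove)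
qed


section \<open>The left ideal \<open>RI\<close>\<close>

lemma left_ideal_RI: "left_ideal UNIV (RI :: 'n::{finite,linorder} diffop set)"
  unfolding RI_def by (rule hull_in) (auto simp: left_ideal_def)

lemma generators_subset_RI: "generators \<subseteq> RI"
  unfolding RI_def I_xy_def by (meson hull_subset subset_trans)

lemma RI_zero: "0 \<in> RI"
  and RI_add: "A \<in> RI \<Longrightarrow> B \<in> RI \<Longrightarrow> A + B \<in> RI"
  and RI_mult: "B \<in> RI \<Longrightarrow> C * B \<in> RI"
  using left_ideal_RI by (auto simp: left_ideal_def)

lemma RI_uminus: "A \<in> RI \<Longrightarrow> - A \<in> RI"
  using RI_mult[of A "- 1"] by simp

lemma RI_sum: "(\<And>i. i \<in> K \<Longrightarrow> A i \<in> RI) \<Longrightarrow> (\<Sum>i\<in>K. A i) \<in> RI"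
  by (induction K rule: infinite_finite_induct) (auto simp: RI_zero intro: RI_add)

lemma RI_if_diff: "A - B \<in> RI \<Longrightarrow> B \<in> RI \<Longrightarrow> A \<in> RI"
  using RI_add[of "A - B" B] by simp

lemma dy_Q_op_in_RI: "dy i * Q_op i \<in> RI"
proof -
  let ?g = "2 * (\<Sum>k\<in>UNIV. coef (rx i k) * dy i * dy k) + coef (ry i) * dy i + 1"
  have "(\<Sum>k\<in>UNIV. coef (rx i k) * dy i * dy k) = (\<Sum>k\<in>UNIV. coef (rx i k) * dy k) * dy i"
    by (simp add: sum_distrib_right mult.assoc dy_commute)
  \<comment> \<open>The constant 1 of the generator is the cost of moving \<open>dy i\<close> past
    \<open>Q_op i\<close>.\<close>
  then have "dy i * Q_op i = - ?g"
    by (simp add: dy_Q_op, simp add: Q_op_alt mult_2 algebra_simps)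
  moreover have "?g \<in> RI"
    using generators_subset_RI unfolding generators_def by blast
  ultimately show ?thesis
    by (simp only: RI_uminus)
qed

lemma dy_P_op_in_RI:
  assumes "i \<notin> J"
  shows "dy i * P_op J \<in> RI"
proof -
  \<comment> \<open>The factor \<open>Q_op i\<close> goes last; the other factors have indices
    different from \<open>i\<close>, so \<open>dy i\<close> passes them and meets
    \<open>Q_op i\<close>.\<close>
  have "P_op J = Q_op i * P_op (insert i J)"
    using P_op_Diff_singleton[of i "insert i J"] assms by simp
  also have "\<dots> = P_op (insert i J) * Q_op i"
    by (intro P_op_commute Q_op_commute)
  also have "dy i * \<dots> = P_op (insert i J) * (dy i * Q_op i)"
  proof -
    have "dy i * P_op (insert i J) = P_op (insert i J) * dy i"
      by (rule P_op_commute) (auto simp: dy_Q_op)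
    then show ?thesis
      by (metis mult.assoc)
  qed
  finally show ?thesis
    by (simp add: RI_mult dy_Q_op_in_RI)
qed

text \<open>The remaining generators commute with every \<open>Q\<^sub>k\<close>, hence can be moved to the right of \<open>P\<^sub>J\<close>.\<close>

lemma dx_P_op_neq:
  assumes "i < j"
  shows "dx i j * P_op J - 2 * dy i * dy j * P_op J \<in> RI"
proof -
  let ?T = "dx i j - 2 * dy i * dy j"
  have "?T * Q_op k = Q_op k * ?T" for k
  proof -
    \<comment> \<open>Twice these corrections are exactly those of \<open>dx i j\<close> in
      \<open>dx_Q_op_neq\<close>.\<close>
    have dydy: "dy i * (dy j * Q_op k) = Q_op k * (dy i * dy j)
        - of_bool (i = k) * dy j - of_bool (j = k) * dy i"
      by (simp add: dy_Q_op right_diff_distrib mult.assoc[symmetric] left_diff_distrib)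
    have "?T * Q_op k = dx i j * Q_op k - 2 * (dy i * (dy j * Q_op k))"
      by (simp add: left_diff_distrib mult.assoc)
    also have "\<dots> = Q_op k * ?T"
      unfolding dydy dx_Q_op_neq[OF less_imp_neq[OF assms]]
      by (simp add: algebra_simps mult_2)
    finally show ?thesis .
  qed
  then have "?T * P_op J = P_op J * ?T"
    by (rule P_op_commute)
  moreover have "?T \<in> RI"
    using assms generators_subset_RI unfolding generators_def by blast
  ultimately show ?thesis
    using RI_mult[of ?T "P_op J"] by (simp add: left_diff_distrib)
qed

lemma dx_P_op_eq: "dx i i * P_op J - dy i ^ 2 * P_op J \<in> RI"
proof -
  let ?T = "dx i i - dy i ^ 2"
  have "?T * Q_op k = Q_op k * ?T" for k
  proof -
    \<comment> \<open>Here both factors \<open>dy i\<close> give the same correction, which already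
      supplies the 2 of \<open>dx_Q_op_eq\<close>; hence \<open>dy i ^ 2\<close> has no factor 2 in
      \<open>?T\<close>.\<close>
    have "dy i * (dy i * Q_op k) = Q_op k * (dy i * dy i) - 2 * of_bool (k = i) * dy i"
      by (simp add: dy_Q_op right_diff_distrib mult.assoc[symmetric] left_diff_distrib)
        (simp add: of_bool_def mult_2)
    then show ?thesis
      by (simp add: dx_Q_op_eq algebra_simps mult_2 power2_eq_square)
  qed
  then have "?T * P_op J = P_op J * ?T"
    by (rule P_op_commute)
  moreover have "?T \<in> RI"
    using generators_subset_RI unfolding generators_def by blast
  ultimately show ?thesis
    using RI_mult[of ?T "P_op J"] by (simp add: left_diff_distrib)
qed


section \<open>Inverting \<open>x\<^sub>J\<close>\<close>

text \<open>Evaluation at \<open>x\<^sub>i\<^sub>i = 1\<close>, with all other variables \<open>0\<close>: the sum of the coefficients of the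
  monomials in the \<open>x\<^sub>i\<^sub>i\<close>.\<close>

definition eval_id :: "'n::linorder polys \<Rightarrow> complex" where
  "eval_id p = (\<Sum>m\<in>Poly_Mapping.keys p.
     if Poly_Mapping.keys m \<subseteq> range (\<lambda>i. xvar i i) then Poly_Mapping.lookup p m else 0)"

text \<open>Allows several polynomials to be evaluated over one common set of monomials.\<close>

lemma eval_id_superset:
  assumes "finite S" "Poly_Mapping.keys p \<subseteq> S"
  shows "eval_id p =
    (\<Sum>m\<in>S. if Poly_Mapping.keys m \<subseteq> range (\<lambda>i. xvar i i) then Poly_Mapping.lookup p m else 0)"
  unfolding eval_id_def using assms by (intro sum.mono_neutral_left) (auto simp: in_keys_iff)

lemma eval_id_add: "eval_id (p + q) = eval_id p + eval_id q"
proof -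
  let ?S = "Poly_Mapping.keys p \<union> Poly_Mapping.keys q"
  show ?thesis
    using Poly_Mapping.keys_add[of p q] unfolding eval_id_superset[of ?S p, simplified]
      eval_id_superset[of ?S q, simplified]
    by (subst eval_id_superset[of ?S]) (auto simp: lookup_add sum.distrib[symmetric] intro!: sum.cong)
qed

lemma eval_id_single:
  "eval_id (Poly_Mapping.single m c) =
    (if Poly_Mapping.keys m \<subseteq> range (\<lambda>i. xvar i i) then c else 0)"
  by (simp add: eval_id_superset[of "{m}"])

lemma eval_id_zero: "eval_id 0 = 0"
  by (simp add: eval_id_def)

lemma keys_add_nat: "Poly_Mapping.keys (m + n :: 'a \<Rightarrow>\<^sub>0 nat) = Poly_Mapping.keys m \<union> Poly_Mapping.keys n"
  by (auto simp: in_keys_iff lookup_add)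

text \<open>By bilinearity monomials suffice. Natural exponents cannot cancel, so a product of
  monomials involves only diagonal variables iff both factors do.\<close>

lemma eval_id_mult: "eval_id (p * q) = eval_id p * eval_id q"
proof (induction p rule: polys_induct)
  case (single m c)
  show ?case
    by (induction q rule: polys_induct)
      (simp_all add: eval_id_zero mult_single eval_id_single keys_add_nat eval_id_add distrib_left)
qed (simp_all add: eval_id_zero eval_id_add distrib_right)

interpretation eval_id: comm_ring_hom eval_id
  using eval_id_single[of 0 1]
  by unfold_locales (simp_all add: eval_id_zero eval_id_add eval_id_mult)

lemma eval_id_xvar: "eval_id (var_poly (xvar i j)) = of_bool (i = j)"
  by (auto simp: var_poly_def eval_id_single xvar_eq_iff)

interpretation to_fract: comm_ring_hom to_fract
  by unfold_locales simp_all

text \<open>\<open>eval_id\<close> sends the polynomial 2 to the complex number 2.\<close>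

lemma two_ratfun_nonzero: "(2 :: 'n::linorder ratfun) \<noteq> 0"
proof -
  have "eval_id (2 :: 'n polys) = eval_id (1 :: 'n polys) + eval_id (1 :: 'n polys)"
    by (simp only: eval_id_add[symmetric] one_add_one)
  then have "(2 :: 'n polys) \<noteq> 0"
    by (auto simp: eval_id_zero)
  moreover have "(2 :: 'n ratfun) = to_fract 2"
    by (simp only: one_add_one[symmetric] to_fract_add to_fract_1)
  ultimately show ?thesis
    by (simp only: to_fract_eq_0_iff not_False_eq_True)
qed

section \<open>The numbering of \<open>J\<close> by \<open>elt\<close> and
  \<open>pos\<close>\<close>

lemma pos_elt:
  assumes "k < card J"
  shows "pos J (elt J k) = k"
proof -
  let ?xs = "sorted_list_of_set J"
  have less: "?xs ! l < ?xs ! k \<longleftrightarrow> l < k" if "l < card J" for l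
    using that assms strict_sorted_list_of_set[of J]
    by (metis sorted_wrt_nth_less length_sorted_list_of_set linorder_neqE_nat order_less_asym order_less_irrefl)
  \<comment> \<open>In the strictly sorted list the elements below entry \<open>k\<close> are those
    at the positions below \<open>k\<close>, and there are \<open>k\<close> of them.\<close>
  have "{j \<in> J. j < elt J k} = (!) ?xs ` {..<k}"
  proof (intro equalityI subsetI)
    fix j assume "j \<in> {j \<in> J. j < elt J k}"
    then obtain l where "l < card J" "j = ?xs ! l" "j < ?xs ! k"
      by (auto simp: elt_def) (metis finite in_set_conv_nth length_sorted_list_of_set set_sorted_list_of_set)
    then show "j \<in> (!) ?xs ` {..<k}"
      using less by auto
  next
    fix j assume "j \<in> (!) ?xs ` {..<k}"
    then show "j \<in> {j \<in> J. j < elt J k}"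
      using assms less nth_mem[of _ ?xs] by (auto simp: elt_def)
  qed
  moreover have "inj_on ((!) ?xs) {..<k}"
    using assms by (intro inj_on_nth) auto
  ultimately show ?thesis
    by (simp add: pos_def card_image)
qed

lemma elt_image: "elt J ` {0..<card J} = J"
proof -
  have "J = set (sorted_list_of_set J)"
    by simp
  also have "\<dots> = elt J ` {0..<card J}"
    unfolding elt_def set_conv_nth by auto
  finally show ?thesis ..
qed

lemma bij_betw_elt: "bij_betw (elt J) {0..<card J} J"
  unfolding bij_betw_def by (intro conjI inj_on_inverseI[of _ "pos J"]) (auto simp: pos_elt elt_image)

lemma
  assumes "i \<in> J"
  shows pos_less: "pos J i < card J" and elt_pos: "elt J (pos J i) = i"
proof -
  have "i \<in> elt J ` {0..<card J}"
    using assms by (simp add: elt_image)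
  then show "pos J i < card J" "elt J (pos J i) = i"
    by (auto simp: pos_elt)
qed

section \<open>Invertibility of \<open>x_mat J\<close> and the entries of its inverse\<close>

lemma x_mat_carrier: "x_mat J \<in> carrier_mat (card J) (card J)"
  by (simp add: x_mat_def)

lemma det_x_mat_nonzero: "det (x_mat J) \<noteq> 0"
proof -
  \<comment> \<open>\<open>eval_id\<close> is defined on polynomials only, so the determinant is
    computed there first; \<open>to_fract\<close> is injective and keeps it nonzero.\<close>
  define X where "X = mat (card J) (card J) (\<lambda>(k, l). var_poly (xvar (elt J k) (elt J l)))"
  have "x_mat J = map_mat to_fract X"
    by (intro eq_matI) (auto simp: x_mat_def X_def rx_def)
  moreover have "elt J k = elt J l \<longleftrightarrow> k = l" if "k < card J" "l < card J" for k l
    using that by (metis pos_elt)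
  then have "map_mat eval_id X = 1\<^sub>m (card J)"
    by (intro eq_matI) (auto simp: X_def eval_id_xvar)
  then have "eval_id (det X) = 1"
    using eval_id.hom_det[of X] by simp
  ultimately show ?thesis
    by (auto simp: eval_id_zero)
qed

lemma Sigma_mat_x_mat:
  "Sigma_mat J \<in> carrier_mat (card J) (card J)"
  "Sigma_mat J * x_mat J = (- 1 / 2) \<cdot>\<^sub>m 1\<^sub>m (card J)"
proof -
  \<comment> \<open>A nonzero determinant over a field makes the matrix a unit, and
    \<open>mat_inverse\<close> returns \<open>None\<close> only for non-units. So \<open>the\<close>
    in \<open>Sigma_mat\<close> yields a genuine inverse.\<close>
  have "mat_inverse (x_mat J) \<noteq> None"
    using mat_inverse(1)[OF x_mat_carrier[of J], of "()"]
      det_non_zero_imp_unit[OF x_mat_carrier[of J] det_x_mat_nonzero, of "()"]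
    by blast
  then obtain B where B: "mat_inverse (x_mat J) = Some B"
    by blast
  note inv = mat_inverse(2)[OF x_mat_carrier B]
  then show "Sigma_mat J \<in> carrier_mat (card J) (card J)"
    by (simp add: Sigma_mat_def B)
  show "Sigma_mat J * x_mat J = (- 1 / 2) \<cdot>\<^sub>m 1\<^sub>m (card J)"
    unfolding Sigma_mat_def B using inv x_mat_carrier[of J]
    by (metis mult_smult_assoc_mat option.sel)
qed

lemma sigma_rx:
  assumes "i \<in> J" "k \<in> J"
  shows "(\<Sum>j\<in>J. sigma J i j * rx j k) = (if i = k then - 1 / 2 else 0)"
proof -
  have "(\<Sum>j\<in>J. sigma J i j * rx j k)
      = (\<Sum>l\<in>{0..<card J}. sigma J i (elt J l) * rx (elt J l) k)"
    by (rule sum.reindex_bij_betw[OF bij_betw_elt, symmetric])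
  also have "\<dots> = (Sigma_mat J * x_mat J) $$ (pos J i, pos J k)"
    using assms Sigma_mat_x_mat(1)[of J]
    by (simp add: x_mat_def scalar_prod_def sigma_def pos_elt pos_less elt_pos)
  also have "\<dots> = (if pos J i = pos J k then - 1 / 2 else 0)"
    using assms by (simp add: Sigma_mat_x_mat(2) pos_less)
  also have "pos J i = pos J k \<longleftrightarrow> i = k"
    using assms by (metis elt_pos)
  finally show ?thesis .
qed

lemma mu_eq_sum:
  assumes "i \<in> J"
  shows "mu J i = (\<Sum>j\<in>J. sigma J i j * ry j)"
proof -
  have "(\<Sum>j\<in>J. sigma J i j * ry j) = (\<Sum>l\<in>{0..<card J}. sigma J i (elt J l) * ry (elt J l))"
    by (rule sum.reindex_bij_betw[OF bij_betw_elt, symmetric])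
  also have "\<dots> = mu J i"
    using assms Sigma_mat_x_mat(1)[of J]
    by (simp add: mu_def mu_vec_def y_vec_def scalar_prod_def sigma_def pos_elt pos_less)
  finally show ?thesis ..
qed


section \<open>The action of the derivations on \<open>P\<^sub>J\<close>\<close>

lemma linear_system_in_RI:
  assumes "j \<in> J"
  shows "P_op (J - {j}) + coef (ry j) * P_op J
    + 2 * (\<Sum>k\<in>J. coef (rx j k) * (dy k * P_op J)) \<in> RI"
proof -
  let ?t = "\<lambda>k. coef (rx j k) * (dy k * P_op J)"
  have "(\<Sum>k\<in>UNIV. coef (rx j k) * dy k) * P_op J = (\<Sum>k\<in>UNIV. ?t k)"
    by (simp add: sum_distrib_right mult.assoc)
  \<comment> \<open>The terms with \<open>k \<notin> J\<close> are split off because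
    \<open>dy_P_op_in_RI\<close> puts them into \<open>RI\<close>.\<close>
  also have "\<dots> = (\<Sum>k\<in>J. ?t k) + (\<Sum>k\<in>-J. ?t k)"
    using sum.Int_Diff[of UNIV ?t J] by (simp add: Compl_eq_Diff_UNIV)
  finally have "P_op (J - {j}) + coef (ry j) * P_op J + 2 * (\<Sum>k\<in>J. ?t k)
      = - (2 * (\<Sum>k\<in>-J. ?t k))"
    by (simp add: P_op_Diff_singleton[OF assms] Q_op_alt algebra_simps)
  moreover have "(\<Sum>k\<in>-J. ?t k) \<in> RI"
    by (auto intro!: RI_sum RI_mult dy_P_op_in_RI)
  ultimately show ?thesis
    by (simp add: RI_mult RI_uminus)
qed

text \<open>Row \<open>i\<close> of \<open>Sigma_mat J\<close> solves the system: the
  \<open>j\<close>-th relation is multiplied from the left by \<open>coef (sigma J i j)\<close> and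
  the results are added, which keeps the sum in the left ideal.\<close>

lemma dy_P_op_cong:
  assumes "i \<in> J"
  shows "dy i * P_op J - (coef (mu J i) * P_op J + (\<Sum>j\<in>J. coef (sigma J i j) * P_op (J - {j}))) \<in> RI"
proof -
  let ?E = "\<lambda>j. P_op (J - {j}) + coef (ry j) * P_op J
    + 2 * (\<Sum>k\<in>J. coef (rx j k) * (dy k * P_op J))"
  let ?S = "\<Sum>j\<in>J. coef (sigma J i j) * P_op (J - {j})"
  have "(\<Sum>j\<in>J. coef (sigma J i j) * (\<Sum>k\<in>J. coef (rx j k) * (dy k * P_op J)))
      = (\<Sum>k\<in>J. coef (\<Sum>j\<in>J. sigma J i j * rx j k) * (dy k * P_op J))"
    unfolding coef_sum coef_mult sum_distrib_right sum_distrib_left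
    by (subst sum.swap) (simp add: mult.assoc)
  also have "\<dots> = (\<Sum>k\<in>J. if k = i then coef (- 1 / 2) * (dy k * P_op J) else 0)"
    using assms by (intro sum.cong) (auto simp: sigma_rx)
  also have "\<dots> = coef (- 1 / 2) * (dy i * P_op J)"
    using assms by simp
  finally have dys: "(\<Sum>j\<in>J. coef (sigma J i j) * (\<Sum>k\<in>J. coef (rx j k) * (dy k * P_op J)))
      = coef (- 1 / 2) * (dy i * P_op J)" .
  \<comment> \<open>The 2 of the system and the \<open>- 1 / 2\<close> from \<open>sigma_rx\<close>
    combine to \<open>- 1\<close>, since 2 is nonzero among the rational functions.\<close>
  have half: "2 * (coef (- 1 / 2) * A) = - A" for A :: "'a diffop"
  proof -
    have "2 * (coef (- 1 / 2) * A) = (coef (- 1 / 2) + coef (- 1 / 2)) * A"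
      by (simp only: mult_2 distrib_right)
    also have "coef (- 1 / 2) + coef (- 1 / 2) = (coef (- 1) :: 'a diffop)"
      by (simp add: coef_add[symmetric] two_ratfun_nonzero)
    finally show ?thesis
      by (simp add: coef_uminus)
  qed
  have "(\<Sum>j\<in>J. coef (sigma J i j) * ?E j) = ?S
      + (\<Sum>j\<in>J. coef (sigma J i j) * (coef (ry j) * P_op J))
      + 2 * (\<Sum>j\<in>J. coef (sigma J i j) * (\<Sum>k\<in>J. coef (rx j k) * (dy k * P_op J)))"
    by (simp add: distrib_left mult_2 sum.distrib algebra_simps)
  also have "(\<Sum>j\<in>J. coef (sigma J i j) * (coef (ry j) * P_op J)) = coef (mu J i) * P_op J"
    by (simp add: mu_eq_sum[OF assms] coef_sum coef_mult sum_distrib_right mult.assoc)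
  also note dys
  also note half
  finally have "dy i * P_op J - (coef (mu J i) * P_op J + ?S)
      = - (\<Sum>j\<in>J. coef (sigma J i j) * ?E j)"
    by (simp add: algebra_simps)
  moreover have "(\<Sum>j\<in>J. coef (sigma J i j) * ?E j) \<in> RI"
    by (intro RI_sum RI_mult linear_system_in_RI)
  ultimately show ?thesis
    by (simp only: RI_uminus)
qed

theorem theorem13:
  fixes J :: "'n::{finite,linorder} set"
  shows "(\<forall>i. dy i * P_op J \<equiv>\<^sub>R\<^sub>I
            (if i \<in> J then coef (mu J i) * P_op J + (\<Sum>j\<in>J. coef (sigma J i j) * P_op (J - {j}))
             else 0))
       \<and> (\<forall>i j. i \<le> j \<longrightarrow> dx i j * P_op J \<equiv>\<^sub>R\<^sub>I
            (if {i, j} \<subseteq> J \<and> i < j then 2 * dy i * dy j * P_op J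
             else if {i} \<subseteq> J \<and> i = j then dy i ^ 2 * P_op J
             else 0))"
proof (intro conjI allI impI)
  fix i
  show "dy i * P_op J \<equiv>\<^sub>R\<^sub>I
      (if i \<in> J then coef (mu J i) * P_op J + (\<Sum>j\<in>J. coef (sigma J i j) * P_op (J - {j})) else 0)"
    using dy_P_op_cong[of i J] dy_P_op_in_RI[of i J] by (simp add: cong_RI_def)
next
  fix i j :: 'n
  assume "i \<le> j"
  \<comment> \<open>The derivatives commute, so one with index outside \<open>J\<close> can stand
    next to \<open>P_op J\<close>. This settles the zero cases, as \<open>dx\<close> acts on
    \<open>P_op J\<close> through second derivatives modulo \<open>RI\<close>.\<close>
  have dydy: "dy k * (dy l * P_op J) \<in> RI" if "k \<notin> J \<or> l \<notin> J" for k l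
    using that RI_mult[OF dy_P_op_in_RI] dy_commute[of k l] by (metis mult.assoc)
  show "dx i j * P_op J \<equiv>\<^sub>R\<^sub>I
      (if {i, j} \<subseteq> J \<and> i < j then 2 * dy i * dy j * P_op J
       else if {i} \<subseteq> J \<and> i = j then dy i ^ 2 * P_op J
       else 0)"
  proof (cases "i = j")
    case True
    have "dx i i * P_op J \<in> RI" if "i \<notin> J"
      using RI_if_diff[OF dx_P_op_eq] dydy[of i i] that by (simp add: power2_eq_square mult.assoc)
    with True dx_P_op_eq[of i J] show ?thesis
      by (simp add: cong_RI_def)
  next
    case False
    with \<open>i \<le> j\<close> have "i < j"
      by simp
    have "dx i j * P_op J \<in> RI" if "i \<notin> J \<or> j \<notin> J"
      using RI_if_diff[OF dx_P_op_neq[OF \<open>i < j\<close>]] RI_mult[OF dydy[OF that]]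
      by (simp add: mult.assoc)
    with False \<open>i < j\<close> dx_P_op_neq[of i j J] show ?thesis
      by (simp add: cong_RI_def)
  qed
qed

end
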